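(* Let $n\ge 1$ be an integer, let $a_0,a_1,\dots,a_n\in\mathbb{Z}$, and let $M,\alpha\ge 1$ be odd integers all of whose prime divisors are congruent to $1$ modulo $4$. Put $$f(x) = \sum_{j=0}^{n-1} a_j \sum_{i=0}^{n-j-1} \binom{n-j}{i}(x+1)^{n-j-i-1}(-1)^i .$$ Suppose that there are integers $k\ge 0$ and $U\ge 0$ such that $$\sum_{j=0}^{n-1} (-1)^{n-j+1}a_j = 4k-1,\qquad \sum_{j=0}^{n-3} (-1)^{n-j-2} a_j (n-j)(n-j-2) + a_{n-1} = 4U-1,$$ $$\sum_{j=0}^{n} (-1)^{n-j+1} a_j = M\alpha^2 .$$ Then $$M(y^2+\alpha^2) \ne (x+1)f(x)\quad\text{for all } (x,y)\in\mathbb{Z}^+\times\mathbb{Z}\text{ with } x>1,\ y\ge 1.$$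
   Context: Empty sums are $0$. The condition on prime divisors is vacuous for the integer $1$. *)

theory Defs
  imports "HOL-Number_Theory.Cong" "HOL-Computational_Algebra.Primes"
begin

text \<open>Exponents and indices are natural numbers. Every subtraction in them is exact on the
  summation ranges used, which are half-open so that they are empty when they should be.\<close>

definition f_poly :: "nat \<Rightarrow> (nat \<Rightarrow> int) \<Rightarrow> int \<Rightarrow> int" where
  "f_poly n a x =
     (\<Sum>j<n. a j * (\<Sum>i<n - j. int ((n - j) choose i) * (x + 1) ^ (n - j - i - 1) * (- 1) ^ i))"

end

theory Submission
  imports Defs "HOL-Number_Theory.Residues"
begin

text \<open>
  By the binomial theorem for \<open>x = (x + 1) - 1\<close>, the inner sum of \<open>f_poly\<close> is the polynomial
  quotient \<open>(x\<^sup>m - (-1)\<^sup>m) / (x + 1)\<close> with \<open>m = n - j\<close>. This makes its values at \<open>0\<close> and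
  \<open>1\<close> explicit. The two signed sums that are assumed to be \<open>-1\<close> modulo \<open>4\<close> are exactly
  \<open>f(0)\<close> and, up to multiples of \<open>4\<close>, \<open>f(1)\<close>; hence \<open>f(x) \<equiv> 3 (mod 4)\<close> whenever
  \<open>x \<equiv> 0\<close> or \<open>x \<equiv> 1 (mod 4)\<close>.

  On the other side, a sum of two squares \<open>y\<^sup>2 + \<alpha>\<^sup>2\<close> can be divisible by a prime
  \<open>p \<equiv> 3 (mod 4)\<close> only if \<open>p\<close> divides \<open>\<alpha>\<close>. So all odd primes dividing
  \<open>N = M (y\<^sup>2 + \<alpha>\<^sup>2)\<close> are \<open>1\<close> modulo \<open>4\<close>, hence so are all positive odd divisors of \<open>N\<close>; and
  \<open>4\<close> does not divide \<open>N\<close>, because \<open>M\<close> and \<open>\<alpha>\<close> are odd. If \<open>N = (x + 1) f(x)\<close>, then \<open>x + 1\<close> and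
  \<open>f(x)\<close> are positive divisors of \<open>N\<close>, so neither is \<open>3\<close> nor \<open>0\<close> modulo \<open>4\<close>. For \<open>x + 1\<close> this
  leaves only \<open>x \<equiv> 0\<close> or \<open>x \<equiv> 1\<close>, and then \<open>f(x) \<equiv> 3\<close> is the contradiction.
\<close>

text \<open>If \<open>p = 4 q + 3\<close> does not divide \<open>b\<close>, it does not divide \<open>a\<close> either, and raising
  \<open>a\<^sup>2 \<equiv> -b\<^sup>2\<close> to the odd power \<open>(p - 1) / 2 = 2 q + 1\<close> gives \<open>1 \<equiv> -1\<close> by Fermat's theorem.\<close>

lemma prime_3_mod_4_dvd_sum_squares:
  fixes p a b :: int
  assumes p: "prime p" and p3: "p mod 4 = 3" and dvd: "p dvd a\<^sup>2 + b\<^sup>2"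
  shows "p dvd b"
proof (rule ccontr)
  assume nb: "\<not> p dvd b"
  have na: "\<not> p dvd a"
  proof
    assume "p dvd a"
    then have "p dvd a\<^sup>2" by (simp add: power2_eq_square)
    with dvd have "p dvd b\<^sup>2" by (simp add: dvd_add_right_iff)
    with p nb show False by (simp add: prime_dvd_power_iff)
  qed
  define q where "q = nat (p div 4)"
  have pq: "p = 4 * int q + 3"
    using p3 prime_gt_0_int[OF p] div_mult_mod_eq[of p 4] unfolding q_def by simp
  have fermat: "[c ^ (4 * q + 2) = 1] (mod p)" if "\<not> p dvd c" for c :: int
  proof -
    have "prime (4 * q + 3)"
      using p pq by (metis of_nat_add of_nat_mult of_nat_numeral prime_nat_int_transfer)
    moreover have "\<not> 4 * q + 3 dvd nat \<bar>c\<bar>"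
      using that pq by (simp flip: int_dvd_int_iff)
    ultimately have "[nat \<bar>c\<bar> ^ (4 * q + 2) = 1] (mod (4 * q + 3))"
      using fermat_theorem[of "4 * q + 3" "nat \<bar>c\<bar>"] by simp
    then have "[int (nat \<bar>c\<bar> ^ (4 * q + 2)) = int 1] (mod int (4 * q + 3))"
      by (simp only: cong_int_iff)
    moreover have "int (nat \<bar>c\<bar> ^ (4 * q + 2)) = c ^ (4 * q + 2)"
      using power_even_abs[of "4 * q + 2" c] by simp
    ultimately show ?thesis
      using pq by (simp only: of_nat_1 of_nat_add of_nat_mult of_nat_numeral)
  qed
  have "[a\<^sup>2 = - (b\<^sup>2)] (mod p)"
    using dvd by (simp add: cong_iff_dvd_diff)
  then have "[(a\<^sup>2) ^ (2 * q + 1) = (- (b\<^sup>2)) ^ (2 * q + 1)] (mod p)"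
    by (rule cong_pow)
  moreover have "(a\<^sup>2) ^ (2 * q + 1) = a ^ (4 * q + 2)"
    by (subst power_mult[symmetric]) simp
  moreover have "(- (b\<^sup>2)) ^ (2 * q + 1) = - (b ^ (4 * q + 2))"
    by (subst power_minus_odd, simp, subst power_mult[symmetric]) simp
  ultimately have "[a ^ (4 * q + 2) = - (b ^ (4 * q + 2))] (mod p)"
    by simp
  then have "[1 = - (b ^ (4 * q + 2))] (mod p)"
    using fermat[OF na] cong_sym cong_trans by blast
  moreover have "[- (b ^ (4 * q + 2)) = - 1] (mod p)"
    using fermat[OF nb] by (simp add: cong_minus_minus_iff)
  ultimately have "[1 = - 1] (mod p)"
    by (rule cong_trans)
  then have "p dvd 2"
    by (simp add: cong_iff_dvd_diff)
  with pq show False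
    using zdvd_imp_le[of p 2] by simp
qed

lemma cong_1_if_prime_divisors_cong_1:
  fixes d m :: int
  assumes "d > 0" and "\<And>p. prime p \<Longrightarrow> p dvd d \<Longrightarrow> [p = 1] (mod m)"
  shows "[d = 1] (mod m)"
proof -
  have "[prod_mset A = 1] (mod m)" if "\<And>p. p \<in># A \<Longrightarrow> [p = 1] (mod m)" for A :: "int multiset"
    using that
  proof (induction A)
    case (add p A)
    then have "[p * prod_mset A = 1 * 1] (mod m)"
      by (intro cong_mult) auto
    then show ?case by simp
  qed simp
  moreover have "[p = 1] (mod m)" if "p \<in># prime_factorization d" for p
    using that assms(2) by (auto simp: in_prime_factors_iff)
  ultimately have "[prod_mset (prime_factorization d) = 1] (mod m)"
    by blast
  then show ?thesis
    using assms(1) by (simp add: prod_mset_prime_factorization)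
qed

text \<open>An odd divisor is a product of primes, each dividing \<open>M\<close> or the sum of squares; in the second
  case a prime \<open>3\<close> modulo \<open>4\<close> would divide \<open>\<alpha>\<close>. An even divisor can only fail to be \<open>2\<close>
  modulo \<open>4\<close> by being a multiple of \<open>4\<close>.\<close>

lemma positive_divisor_mod_4:
  fixes M y \<alpha> d :: int
  assumes M: "odd M" "\<And>p::int. prime p \<Longrightarrow> p dvd M \<Longrightarrow> [p = 1] (mod 4)"
    and \<alpha>: "odd \<alpha>" "\<And>p::int. prime p \<Longrightarrow> p dvd \<alpha> \<Longrightarrow> [p = 1] (mod 4)"
    and d: "d > 0" "d dvd M * (y\<^sup>2 + \<alpha>\<^sup>2)"
  shows "d mod 4 = 1 \<or> d mod 4 = 2"
proof (cases "even d")
  case True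
  \<comment> \<open>Squares are \<open>0\<close> or \<open>1\<close> modulo \<open>4\<close>, and \<open>\<alpha>\<^sup>2 \<equiv> 1\<close>; so the sum is never \<open>0\<close>.\<close>
  have "\<not> 4 dvd y\<^sup>2 + \<alpha>\<^sup>2"
  proof -
    have "\<alpha> mod 4 = 1 \<or> \<alpha> mod 4 = 3" using \<alpha>(1) by presburger
    then have "\<alpha>\<^sup>2 mod 4 = 1" by (auto simp: power_mod[symmetric, of \<alpha>])
    moreover have "y mod 4 = 0 \<or> y mod 4 = 1 \<or> y mod 4 = 2 \<or> y mod 4 = 3" by presburger
    then have "y\<^sup>2 mod 4 = 0 \<or> y\<^sup>2 mod 4 = 1" by (auto simp: power_mod[symmetric, of y])
    ultimately show ?thesis by presburger
  qed
  moreover have "coprime (4::int) M"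
  proof -
    have "coprime ((2::int)\<^sup>2) M" using M(1) by (simp only: coprime_power_left_iff) simp
    then show ?thesis by simp
  qed
  ultimately have "\<not> 4 dvd M * (y\<^sup>2 + \<alpha>\<^sup>2)"
    by (simp add: coprime_dvd_mult_right_iff)
  then have "\<not> 4 dvd d" using d(2) dvd_trans by blast
  with True show ?thesis by presburger
next
  case False
  have "[d = 1] (mod 4)"
  proof (rule cong_1_if_prime_divisors_cong_1[OF d(1)])
    fix p :: int
    assume p: "prime p" "p dvd d"
    with d(2) have "p dvd M * (y\<^sup>2 + \<alpha>\<^sup>2)" using dvd_trans by blast
    then consider "p dvd M" | "p dvd y\<^sup>2 + \<alpha>\<^sup>2"
      using p(1) by (auto simp: prime_dvd_mult_iff)
    then show "[p = 1] (mod 4)"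
    proof cases
      case 1
      then show ?thesis using M(2) p(1) by blast
    next
      case 2
      have "odd p" using False p(2) dvd_trans by blast
      then have "p mod 4 = 1 \<or> p mod 4 = 3" by presburger
      then consider "p mod 4 = 1" | "p mod 4 = 3" by blast
      then show ?thesis
      proof cases
        case 1
        then show ?thesis by (simp add: cong_def)
      next
        case 2
        then show ?thesis
          using prime_3_mod_4_dvd_sum_squares[OF p(1) _ \<open>p dvd y\<^sup>2 + \<alpha>\<^sup>2\<close>] \<alpha>(2) p(1) by blast
      qed
    qed
  qed
  then show ?thesis by (simp add: cong_def)
qed

text \<open>The sum is the binomial expansion of \<open>((x + 1) - 1)\<^sup>m\<close> without its last term \<open>(-1)\<^sup>m\<close>,
  divided by \<open>x + 1\<close>.\<close>

lemma f_poly_inner_sum: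
  fixes x :: int
  shows "(x + 1) * (\<Sum>i<m. int (m choose i) * (x + 1) ^ (m - i - 1) * (- 1) ^ i)
    = x ^ m - (- 1) ^ m"
proof -
  have "x ^ m = (- 1 + (x + 1)) ^ m" by simp
  also have "\<dots> = (\<Sum>i\<le>m. int (m choose i) * (- 1) ^ i * (x + 1) ^ (m - i))"
    by (rule binomial_ring)
  also have "\<dots> = (\<Sum>i<m. int (m choose i) * (- 1) ^ i * (x + 1) ^ (m - i)) + (- 1) ^ m"
    by (simp flip: lessThan_Suc_atMost)
  also have "(\<Sum>i<m. int (m choose i) * (- 1) ^ i * (x + 1) ^ (m - i))
    = (\<Sum>i<m. (x + 1) * (int (m choose i) * (x + 1) ^ (m - i - 1) * (- 1) ^ i))"
  proof (rule sum.cong[OF refl])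
    fix i assume "i \<in> {..<m}"
    then have "m - i = Suc (m - i - 1)" by simp
    then have "(x + 1) ^ (m - i) = (x + 1) * (x + 1) ^ (m - i - 1)"
      by (metis power_Suc)
    then show "int (m choose i) * (- 1) ^ i * (x + 1) ^ (m - i)
      = (x + 1) * (int (m choose i) * (x + 1) ^ (m - i - 1) * (- 1) ^ i)"
      by (simp add: mult_ac)
  qed
  finally show ?thesis by (simp add: sum_distrib_left)
qed

lemma f_poly_0: "f_poly n a 0 = (\<Sum>j<n. (- 1) ^ (n - j + 1) * a j)"
  unfolding f_poly_def using f_poly_inner_sum[of 0]
  by (intro sum.cong) (simp_all add: power_0_left)

lemma f_poly_1: "f_poly n a 1 = (\<Sum>j<n. if odd (n - j) then a j else 0)"
proof -
  have quotient: "(\<Sum>i<m. int (m choose i) * (1 + 1) ^ (m - i - 1) * (- 1) ^ i) = (if odd m then 1 else 0)"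
    for m
    using f_poly_inner_sum[of 1 m] by (cases "odd m") simp_all
  show ?thesis
    unfolding f_poly_def quotient by (simp only: if_distrib mult_1_right mult_zero_right)
qed

lemma f_poly_cong:
  assumes "[x = y] (mod m)"
  shows "[f_poly n a x = f_poly n a y] (mod m)"
  unfolding f_poly_def
  by (intro cong_sum cong_mult cong_pow cong_add assms cong_refl)

text \<open>For odd \<open>m = n - j\<close> one has \<open>m (m - 2) = (m - 1)\<^sup>2 - 1 \<equiv> -1 (mod 4)\<close>, and the sign
  \<open>(-1)\<^bsup>m - 2\<^esup> = -1\<close> turns this into the coefficient \<open>1\<close> of \<open>f(1)\<close>; for even \<open>m\<close> the product
  is divisible by \<open>4\<close>. The index \<open>m = 1\<close> is the separate summand \<open>a (n - 1)\<close>, and \<open>m = 2\<close>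
  contributes nothing.\<close>

lemma f_poly_1_cong:
  assumes "n \<ge> 1"
  shows "[(\<Sum>j<n - 2. (- 1) ^ (n - j - 2) * a j * int (n - j) * int (n - j - 2)) + a (n - 1)
    = f_poly n a 1] (mod 4)"
proof -
  have "[(\<Sum>j<n - 2. (- 1) ^ (n - j - 2) * a j * int (n - j) * int (n - j - 2))
    = (\<Sum>j<n - 2. if odd (n - j) then a j else 0)] (mod 4)"
  proof (rule cong_sum)
    fix j assume "j \<in> {..<n - 2}"
    then obtain r where r: "n - j = r + 2"
      by (metis add.commute le_add_diff_inverse less_diff_conv lessThan_iff less_imp_le_nat)
    show "[(- 1) ^ (n - j - 2) * a j * int (n - j) * int (n - j - 2)
      = (if odd (n - j) then a j else 0)] (mod 4)"
    proof (cases "odd r")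
      case True
      then obtain s where "r = 2 * s + 1" by (rule oddE)
      then show ?thesis
        unfolding r by (simp add: cong_iff_dvd_diff algebra_simps)
    next
      case False
      then obtain s where "r = 2 * s" by blast
      then show ?thesis
        unfolding r by (simp add: cong_iff_dvd_diff algebra_simps)
    qed
  qed
  moreover have "f_poly n a 1 = (\<Sum>j<n - 2. if odd (n - j) then a j else 0) + a (n - 1)"
  proof (cases "n = 1")
    case True
    then show ?thesis by (simp add: f_poly_1)
  next
    case False
    with assms obtain r where "n = Suc (Suc r)"
      by (metis le_eq_less_or_eq less_imp_Suc_add plus_1_eq_Suc)
    then show ?thesis by (simp add: f_poly_1)
  qed
  ultimately show ?thesis
    by (simp add: cong_add_rcancel)
qed

theorem theorem2p4:
  fixes n :: nat and a :: "nat \<Rightarrow> int" and M \<alpha> k U :: int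
  assumes "n \<ge> 1"
    and "M \<ge> 1" and "odd M" and "\<And>p::int. prime p \<Longrightarrow> p dvd M \<Longrightarrow> [p = 1] (mod 4)"
    and "\<alpha> \<ge> 1" and "odd \<alpha>" and "\<And>p::int. prime p \<Longrightarrow> p dvd \<alpha> \<Longrightarrow> [p = 1] (mod 4)"
    and "k \<ge> 0" and "U \<ge> 0"
    and "(\<Sum>j<n. (- 1) ^ (n - j + 1) * a j) = 4 * k - 1"
    and "(\<Sum>j<n - 2. (- 1) ^ (n - j - 2) * a j * int (n - j) * int (n - j - 2)) + a (n - 1)
           = 4 * U - 1"
    and "(\<Sum>j\<le>n. (- 1) ^ (n - j + 1) * a j) = M * \<alpha>\<^sup>2"
  shows "\<forall>x y :: int. x > 0 \<and> x > 1 \<and> y \<ge> 1 \<longrightarrow> M * (y\<^sup>2 + \<alpha>\<^sup>2) \<noteq> (x + 1) * f_poly n a x"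
proof (intro allI impI notI)
  fix x y :: int
  assume xy: "x > 0 \<and> x > 1 \<and> y \<ge> 1"
    and eq: "M * (y\<^sup>2 + \<alpha>\<^sup>2) = (x + 1) * f_poly n a x"
  note divisor = positive_divisor_mod_4[OF assms(3,4,6,7), where y = y]
  have "(x + 1) mod 4 = 1 \<or> (x + 1) mod 4 = 2"
    using divisor[of "x + 1"] xy eq by simp
  then have "x mod 4 = 0 \<or> x mod 4 = 1"
    by presburger
  then have x: "[x = 0] (mod 4) \<or> [x = 1] (mod 4)"
    by (auto simp: cong_def)
  have "M * (y\<^sup>2 + \<alpha>\<^sup>2) > 0"
    using assms(2,5) by (intro mult_pos_pos add_nonneg_pos) auto
  then have "f_poly n a x > 0"
    using xy eq by (simp add: zero_less_mult_iff)
  then have "f_poly n a x mod 4 = 1 \<or> f_poly n a x mod 4 = 2"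
    using divisor eq by simp
  moreover have "[f_poly n a 0 = - 1] (mod 4)"
    unfolding f_poly_0 assms(10) by (simp add: cong_iff_dvd_diff)
  moreover have "[f_poly n a 1 = - 1] (mod 4)"
  proof -
    have "[4 * U - 1 = f_poly n a 1] (mod 4)"
      using f_poly_1_cong[OF assms(1), of a] unfolding assms(11) .
    moreover have "[4 * U - 1 = - 1] (mod 4)"
      by (simp add: cong_iff_dvd_diff)
    ultimately show ?thesis
      using cong_sym cong_trans by blast
  qed
  moreover have "[f_poly n a x = f_poly n a 0] (mod 4) \<or> [f_poly n a x = f_poly n a 1] (mod 4)"
    using x f_poly_cong by blast
  ultimately show False
    unfolding cong_def by auto
qed

end
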